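(* Let $G$ be a finite simple graph that is 3-regular and is a circle graph. Then $G$ has at least two disjoint pairs of twin vertices; that is, there exist four distinct vertices $v_1,v_2,w_1,w_2$ of $G$ such that $\{v_1,v_2\}$ is a pair of twins and $\{w_1,w_2\}$ is a pair of twins.
   Context: A double occurrence word is a finite sequence $w_1\dots w_{2n}$ in which $n$ distinct letters appear, each exactly twice. Its interlacement graph $\mathcal{I}(W)$ is the simple graph whose vertices are the $n$ letters, with two letters $a,b$ adjacent iff they appear in $W$ in the (not necessarily consecutive) order $abab$ or $baba$. A simple graph is a circle graph if it is isomorphic to the interlacement graph of some double occurrence word. Two distinct vertices $v_1,v_2$ of a simple graph are twins if they have the same neighbors outside $\{v_1,v_2\}$, i.e. $N(v_1)\setminus\{v_2\}=N(v_2)\setminus\{v_1\}$, where $N(v)$ is the open neighborhood of $v$. They are adjacent twins if moreover $v_1v_2$ is an edge, nonadjacent twins otherwise. *)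

theory Defs
  imports Main
begin

definition simple_graph :: "'a set \<Rightarrow> ('a \<Rightarrow> 'a \<Rightarrow> bool) \<Rightarrow> bool" where
  "simple_graph V E \<longleftrightarrow> finite V \<and> (\<forall>u v. E u v \<longrightarrow> u \<in> V \<and> v \<in> V)
     \<and> (\<forall>u v. E u v \<longrightarrow> E v u) \<and> (\<forall>u. \<not> E u u)"

definition neighbors :: "'a set \<Rightarrow> ('a \<Rightarrow> 'a \<Rightarrow> bool) \<Rightarrow> 'a \<Rightarrow> 'a set" where
  "neighbors V E v = {u \<in> V. E v u}"

definition regular :: "nat \<Rightarrow> 'a set \<Rightarrow> ('a \<Rightarrow> 'a \<Rightarrow> bool) \<Rightarrow> bool" where
  "regular k V E \<longleftrightarrow> (\<forall>v\<in>V. card (neighbors V E v) = k)"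

definition double_occurrence_word :: "'b list \<Rightarrow> bool" where
  "double_occurrence_word w \<longleftrightarrow> (\<forall>x \<in> set w. count_list w x = 2)"

definition interlaced :: "'b list \<Rightarrow> 'b \<Rightarrow> 'b \<Rightarrow> bool" where
  "interlaced w a b \<longleftrightarrow> a \<noteq> b \<and>
     ((\<exists>i j k l. i < j \<and> j < k \<and> k < l \<and> l < length w \<and>
         w ! i = a \<and> w ! j = b \<and> w ! k = a \<and> w ! l = b) \<or>
      (\<exists>i j k l. i < j \<and> j < k \<and> k < l \<and> l < length w \<and>
         w ! i = b \<and> w ! j = a \<and> w ! k = b \<and> w ! l = a))"

text \<open>Circle graph: isomorphic to the interlacement graph (vertices set w, edges interlaced w)
  of some double occurrence word w (letters taken as naturals, w.l.o.g.).\<close>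
definition circle_graph :: "'a set \<Rightarrow> ('a \<Rightarrow> 'a \<Rightarrow> bool) \<Rightarrow> bool" where
  "circle_graph V E \<longleftrightarrow> (\<exists>(w :: nat list) f. double_occurrence_word w \<and>
     bij_betw f V (set w) \<and> (\<forall>u\<in>V. \<forall>v\<in>V. E u v \<longleftrightarrow> interlaced w (f u) (f v)))"

definition twins :: "'a set \<Rightarrow> ('a \<Rightarrow> 'a \<Rightarrow> bool) \<Rightarrow> 'a \<Rightarrow> 'a \<Rightarrow> bool" where
  "twins V E v1 v2 \<longleftrightarrow> v1 \<in> V \<and> v2 \<in> V \<and> v1 \<noteq> v2 \<and>
     neighbors V E v1 - {v2} = neighbors V E v2 - {v1}"

end

theory Submission
  imports Defs
begin

text \<open>
  The argument looks at an interval of a word whose interlacement graph is cubic. Call a letter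
  with exactly one occurrence in the interval an exit, and one with both occurrences in it inner.
  Suppose that there are at most three exits, that each of them meets at most two inner letters,
  and that no two inner letters are twins. If there are inner letters at all, then the interval
  reads \<open>u a b c u\<close> or \<open>u a v b u c v\<close>, with exits \<open>a, b, c\<close>. Indeed, by induction this
  describes the interior of every inner chord \<open>p\<close>, so \<open>p\<close> spans three exits, or it spans the
  second pattern (in the first one, \<open>p\<close> and \<open>u\<close> are twins). In the second case the middle exit \<open>b\<close> is also an exit of the large
  interval and meets the three inner letters \<open>u, v, p\<close>, which is excluded. So all inner chords have the form
  \<open>x \<cdot> \<cdot> \<cdot> x\<close>. Two of them starting at consecutive places are twins, and therefore the leftmost
  and the rightmost one contain at least two exits each, which leaves only the two patterns.

  Intervals with at most two exits thus contain twins as soon as they have an inner letter; the whole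
  word yields a first pair. The two chords of this pair cut the circle into four arcs, and
  applying the above to these arcs gives a second pair disjoint from the first, inside an arc or
  among the few chords that join the arcs when no arc has an inner letter.
\<close>

section \<open>Interlacement in words and its invariance under rotation\<close>

definition nbh :: "'b list \<Rightarrow> 'b \<Rightarrow> 'b set" where
  "nbh w x = {y. interlaced w x y}"

definition letter_twins :: "'b list \<Rightarrow> 'b \<Rightarrow> 'b \<Rightarrow> bool" where
  "letter_twins w x y \<longleftrightarrow> x \<in> set w \<and> y \<in> set w \<and> x \<noteq> y \<and> nbh w x - {y} = nbh w y - {x}"

lemma interlaced_sym: "interlaced w a b \<longleftrightarrow> interlaced w b a"
  unfolding interlaced_def by blast

lemma interlacedI:
  assumes "i < j" "j < k" "k < l" "l < length w" "w ! k = w ! i" "w ! l = w ! j" "w ! i \<noteq> w ! j"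
  shows "interlaced w (w ! i) (w ! j)"
  unfolding interlaced_def using assms
  by (intro conjI disjI1 exI[of _ i] exI[of _ j] exI[of _ k] exI[of _ l]) simp_all

text \<open>One list of positions serves both patterns, and only the last fact tells which letter
  comes first. This postpones the split between \<open>abab\<close> and \<open>baba\<close> until
  the letters matter.\<close>

lemma interlacedE:
  assumes "interlaced w a b"
  obtains i j k l where "i < j" "j < k" "k < l" "l < length w" "w ! k = w ! i" "w ! l = w ! j" "a \<noteq> b"
    "w ! i = a \<and> w ! j = b \<or> w ! i = b \<and> w ! j = a"
proof -
  from assms have ne: "a \<noteq> b" unfolding interlaced_def by (rule conjunct1)
  from assms show thesis
    unfolding interlaced_def
  proof (elim conjE disjE exE, goal_cases)
    case (1 i j k l)
    then show ?case by (intro that[of i j k l]) simp_all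
  next
    case (2 i j k l)
    then show ?case by (intro that[of i j k l]) simp_all
  qed
qed

lemma interlaced_in_set: "interlaced w a b \<Longrightarrow> a \<in> set w \<and> b \<in> set w"
  unfolding interlaced_def by (auto dest: nth_mem)

text \<open>Position \<open>k\<close> of \<open>rotate1 w\<close> is position \<open>Suc k\<close>
  of \<open>w\<close>, except that the last one is position 0. So only \<open>l\<close> can wrap
  around; it then comes first and turns \<open>abab\<close> into \<open>baba\<close>.\<close>

lemma interlaced_rotate1_D:
  assumes "interlaced (rotate1 w) a b"
  shows "interlaced w a b"
proof -
  obtain i j k l where h: "i < j" "j < k" "k < l" "l < length w"
    "rotate1 w ! k = rotate1 w ! i" "rotate1 w ! l = rotate1 w ! j" "a \<noteq> b"
    and ab: "rotate1 w ! i = a \<and> rotate1 w ! j = b \<or> rotate1 w ! i = b \<and> rotate1 w ! j = a"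
    using assms by (elim interlacedE) simp
  let ?x = "rotate1 w ! i" and ?y = "rotate1 w ! j"
  have ne: "?x \<noteq> ?y" using ab h(7) by auto
  have rot: "rotate1 w ! i = w ! Suc i" "rotate1 w ! j = w ! Suc j" "rotate1 w ! k = w ! Suc k"
    using h by (simp_all add: nth_rotate1)
  have "interlaced w ?x ?y \<or> interlaced w ?y ?x"
  proof (cases "Suc l = length w")
    case False
    then have "rotate1 w ! l = w ! Suc l" using h by (simp add: nth_rotate1)
    then have "interlaced w (w ! Suc i) (w ! Suc j)"
      using h rot ne False by (intro interlacedI[of _ _ "Suc k" "Suc l"]) simp_all
    then show ?thesis using rot by simp
  next
    case True
    then have l: "rotate1 w ! l = w ! 0" using h by (simp add: nth_rotate1)
    then have "interlaced w (w ! 0) (w ! Suc i)"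
      using h rot ne True by (intro interlacedI[of _ _ "Suc j" "Suc k"]) simp_all
    then show ?thesis using rot l h(6) by simp
  qed
  then have "interlaced w ?x ?y" "interlaced w ?y ?x"
    using interlaced_sym[of w ?x ?y] by blast+
  then show ?thesis using ab by auto
qed

lemma interlaced_rotate_D: "interlaced (rotate n w) a b \<Longrightarrow> interlaced w a b"
  by (induction n) (auto dest: interlaced_rotate1_D)

lemma interlaced_rotate: "interlaced (rotate n w) a b \<longleftrightarrow> interlaced w a b"
proof
  assume "interlaced w a b"
  \<comment> \<open>The two rotations together shift by a multiple of the length, so the one-sided
    result, applied to the rotated word, gives the converse.\<close>
  moreover have undo: "rotate (length w * n - n) (rotate n w) = w"
  proof (cases "length w")
    case (Suc m)
    then have "rotate (length w * n - n) (rotate n w) = rotate (length w * n) w"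
      by (simp add: rotate_rotate add.commute)
    also have "\<dots> = w" by (rule rotate_id) simp
    finally show ?thesis .
  qed simp
  ultimately show "interlaced (rotate n w) a b"
    using interlaced_rotate_D[of "length w * n - n" "rotate n w" a b] unfolding undo by blast
qed (rule interlaced_rotate_D)

lemma nbh_rotate [simp]: "nbh (rotate n w) = nbh w"
  by (auto simp: nbh_def interlaced_rotate)

lemma letter_twins_rotate [simp]: "letter_twins (rotate n w) = letter_twins w"
  by (auto simp: letter_twins_def fun_eq_iff)

section \<open>Chords, exits and inner letters of a cubic word\<close>

locale cubic_word =
  fixes w :: "'b list"
  assumes dow: "double_occurrence_word w"
    and deg3: "x \<in> set w \<Longrightarrow> card (nbh w x) = 3"
begin

abbreviation N :: nat where "N \<equiv> length w"

text \<open>Positions are points on a circle, and \<open>k\<close> and \<open>mate k\<close> are the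
  two ends of a chord. The description is unique for \<open>k < N\<close>, by
  \<open>ex1_mate\<close>.\<close>

definition mate :: "nat \<Rightarrow> nat" where
  "mate k = (THE l. l < N \<and> l \<noteq> k \<and> w ! l = w ! k)"

lemma ex1_mate:
  assumes "k < N"
  shows "\<exists>!l. l < N \<and> l \<noteq> k \<and> w ! l = w ! k"
proof -
  have "count_list w (w ! k) = 2"
    using dow assms by (simp add: double_occurrence_word_def)
  moreover have "count_list w (w ! k) = card {l. l < N \<and> w ! l = w ! k}"
    unfolding count_list_eq_length_filter length_filter_conv_card by (rule arg_cong[of _ _ card]) auto
  ultimately have "card {l. l < N \<and> w ! l = w ! k} = 2" by simp
  then obtain a b where ab: "{l. l < N \<and> w ! l = w ! k} = {a, b}" "a \<noteq> b"
    unfolding card_2_iff by blast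
  have iff: "l < N \<and> w ! l = w ! k \<longleftrightarrow> l = a \<or> l = b" for l
  proof -
    have "l \<in> {l. l < N \<and> w ! l = w ! k} \<longleftrightarrow> l \<in> {a, b}" by (simp only: ab(1))
    then show ?thesis by simp
  qed
  have "k = a \<or> k = b" using assms iff[of k] by simp
  then show ?thesis
  proof
    assume "k = a"
    then show ?thesis using iff ab(2) by (intro ex1I[of _ b]) auto
  next
    assume "k = b"
    then show ?thesis using iff ab(2) by (intro ex1I[of _ a]) auto
  qed
qed

lemma mate_props:
  assumes "k < N"
  shows mate_less: "mate k < N" and mate_neq: "mate k \<noteq> k" and nth_mate: "w ! mate k = w ! k"
  using theI'[OF ex1_mate[OF assms]] unfolding mate_def by auto

lemma nth_eq_iff: "k < N \<Longrightarrow> l < N \<Longrightarrow> w ! k = w ! l \<longleftrightarrow> l = k \<or> l = mate k"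
  using ex1_mate[of k] mate_props[of k] by metis

lemma mate_mate [simp]: "k < N \<Longrightarrow> mate (mate k) = k"
  using nth_eq_iff[of "mate k" k] mate_props[of k] by metis

text \<open>Exits are kept as positions, since their order along the interval matters. Inner letters
  are kept as letters, to be intersected with neighbourhoods.\<close>

definition exits :: "nat \<Rightarrow> nat \<Rightarrow> nat set" where
  "exits i j = {k \<in> {i..<j}. mate k \<notin> {i..<j}}"

definition inner :: "nat \<Rightarrow> nat \<Rightarrow> 'b set" where
  "inner i j = {w ! k |k. k \<in> {i..<j} \<and> mate k \<in> {i..<j}}"

lemma finite_exits [simp]: "finite (exits i j)"
  by (simp add: exits_def)

text \<open>Chords cross when exactly one end of the second lies strictly between the ends of the
  first. Starting at \<open>Suc p\<close> leaves out the left end, half-openness the right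
  one.\<close>

lemma interlaced_iff:
  assumes "p < N" "p < mate p"
  shows "interlaced w (w ! p) y \<longleftrightarrow> (\<exists>k \<in> exits (Suc p) (mate p). y = w ! k)"
proof
  assume il: "interlaced w (w ! p) y"
  note mp = mate_props[OF assms(1)]
  obtain i j k l where h: "i < j" "j < k" "k < l" "l < N" "w ! k = w ! i" "w ! l = w ! j"
    and e: "w ! i = w ! p \<and> w ! j = y \<or> w ! i = y \<and> w ! j = w ! p"
    by (rule interlacedE[OF il])
  \<comment> \<open>The alternating positions form the mate pairs \<open>i\<close>, \<open>k\<close>
    and \<open>j\<close>, \<open>l\<close>; as \<open>p\<close> is the left end of its chord, it is
    \<open>i\<close> or \<open>j\<close>.\<close>
  have ki: "mate i = k" "mate k = i" and lj: "mate j = l"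
    using nth_eq_iff[of i k] nth_eq_iff[of k i] nth_eq_iff[of j l] h by auto
  from e show "\<exists>k \<in> exits (Suc p) (mate p). y = w ! k"
  proof
    assume e1: "w ! i = w ! p \<and> w ! j = y"
    then have "i = p \<or> i = mate p" using assms h nth_eq_iff[of p i] by simp
    moreover have "i \<noteq> mate p"
    proof
      assume i: "i = mate p"
      then have "k = p" using ki(1) mate_mate[OF assms(1)] by simp
      then show False using i h assms by simp
    qed
    ultimately have "i = p" by blast
    then have "j \<in> exits (Suc p) (mate p)"
      using h(1-3) ki lj by (simp add: exits_def)
    then show ?thesis using e1 by auto
  next
    assume e1: "w ! i = y \<and> w ! j = w ! p"
    then have "j = p \<or> j = mate p" using assms h nth_eq_iff[of p j] by simp
    moreover have "j \<noteq> mate p"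
    proof
      assume j: "j = mate p"
      then have "l = p" using lj mate_mate[OF assms(1)] by simp
      then show False using j h assms by simp
    qed
    ultimately have j: "j = p" by blast
    then have "k \<in> exits (Suc p) (mate p)"
      using h(1-3) ki lj by (simp add: exits_def)
    moreover have "y = w ! k" using e1 h(5) by simp
    ultimately show ?thesis by blast
  qed
next
  assume "\<exists>k \<in> exits (Suc p) (mate p). y = w ! k"
  then obtain k where "k \<in> exits (Suc p) (mate p)" and y: "y = w ! k" by blast
  then have k: "p < k" "k < mate p" "mate k < Suc p \<or> mate p \<le> mate k" "y = w ! k"
    by (auto simp: exits_def)
  note mp = mate_props[OF assms(1)]
  have kN: "k < N" using k mp by simp
  note mk = mate_props[OF kN]
  have ne: "mate k \<noteq> p" "mate k \<noteq> mate p"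
    using k mate_mate[OF kN] mate_mate[OF assms(1)] by auto
  have "w ! p \<noteq> y" using nth_eq_iff[OF assms(1) kN] k by auto
  moreover have "mate k < p \<or> mate p < mate k" using k ne by auto
  ultimately consider "mate k < p" | "mate p < mate k" by blast
  then show "interlaced w (w ! p) y"
  proof cases
    case 1
    have "interlaced w (w ! mate k) (w ! p)"
      using mk(3) mp(3) k(4) \<open>w ! p \<noteq> y\<close> by (intro interlacedI[OF 1 k(1,2) mp(1)]) simp_all
    then have "interlaced w y (w ! p)" using mk(3) k(4) by simp
    then show ?thesis by (rule interlaced_sym[THEN iffD1])
  next
    case 2
    have "interlaced w (w ! p) (w ! k)"
      using mk(3) mp(3) k(4) \<open>w ! p \<noteq> y\<close> by (intro interlacedI[OF k(1,2) 2 mk(1)]) simp_all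
    then show ?thesis using k(4) by simp
  qed
qed

lemma nbh_eq:
  assumes "p < N" "p < mate p"
  shows "nbh w (w ! p) = (!) w ` exits (Suc p) (mate p)"
  using interlaced_iff[OF assms] by (auto simp: nbh_def)

lemma inj_exits: "j \<le> N \<Longrightarrow> inj_on ((!) w) (exits i j)"
  by (intro inj_onI) (auto simp: exits_def nth_eq_iff)

lemma card_exits_chord:
  assumes "p < N" "p < mate p"
  shows "card (exits (Suc p) (mate p)) = 3"
  using deg3[of "w ! p"] nbh_eq[OF assms] inj_exits[of "mate p" "Suc p"] assms mate_less[of p]
  by (simp add: card_image)

lemma finite_nbh [simp]: "finite (nbh w x)"
proof (rule finite_subset)
  show "nbh w x \<subseteq> set w" by (auto simp: nbh_def dest: interlaced_in_set)
qed simp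

lemma nbh_sym: "y \<in> nbh w x \<longleftrightarrow> x \<in> nbh w y"
  unfolding nbh_def using interlaced_sym by fast

lemma exits_chord_nbh:
  assumes "p < N" "p < mate p" "k \<in> exits (Suc p) (mate p)"
  shows "w ! p \<in> nbh w (w ! k)"
  using nbh_eq[OF assms(1,2)] assms(3) nbh_sym by auto

text \<open>Such an exit is adjacent to the letter of the chord itself, which is not inner, so only
  two of its three neighbours remain. This lets \<open>few_exits_cases\<close> be applied
  inductively to chord interiors.\<close>

lemma exits_of_chord_interior:
  assumes "p < N" "p < mate p" "k \<in> exits (Suc p) (mate p)"
  shows "card (nbh w (w ! k) \<inter> inner (Suc p) (mate p)) \<le> 2"
proof -
  have kN: "k < N" using assms mate_less[of p] by (auto simp: exits_def)
  have "w ! p \<notin> inner (Suc p) (mate p)"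
    using assms mate_less[of p] nth_eq_iff[of p] by (auto simp: inner_def)
  then have "nbh w (w ! k) \<inter> inner (Suc p) (mate p) \<subseteq> nbh w (w ! k) - {w ! p}" by auto
  then have "card (nbh w (w ! k) \<inter> inner (Suc p) (mate p)) \<le> card (nbh w (w ! k) - {w ! p})"
    by (intro card_mono) auto
  also have "\<dots> = 2"
    using exits_chord_nbh[OF assms] deg3[of "w ! k"] kN by simp
  finally show ?thesis .
qed

section \<open>Intervals with at most three exits\<close>

lemma inner_mono: "i \<le> i' \<Longrightarrow> j' \<le> j \<Longrightarrow> inner i' j' \<subseteq> inner i j"
  by (force simp: inner_def)

text \<open>Strong induction on the length, used for the interior of each inner chord: it has three
  exits by \<open>card_exits_chord\<close> and inherits the absence of twins by
  \<open>inner_mono\<close>. The conclusion names exact positions, so that chords starting nearby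
  can be compared by arithmetic.\<close>

lemma few_exits_cases:
  assumes "j \<le> N" "card (exits i j) \<le> 3"
    and "\<And>k. k \<in> exits i j \<Longrightarrow> card (nbh w (w ! k) \<inter> inner i j) \<le> 2"
    and "\<And>x y. x \<in> inner i j \<Longrightarrow> y \<in> inner i j \<Longrightarrow> \<not> letter_twins w x y"
    and "inner i j \<noteq> {}"
  shows "(j = i + 5 \<and> mate i = i + 4 \<and> exits i j = {i+1, i+2, i+3}) \<or>
    (j = i + 7 \<and> mate i = i + 4 \<and> mate (i+2) = i + 6 \<and> exits i j = {i+1, i+3, i+5})"
  using assms
proof (induction "j - i" arbitrary: i j rule: less_induct)
  case less
  note jN = less.prems(1) and ntw = less.prems(4)
  \<comment> \<open>Inner chords are represented by their left ends.\<close>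
  define F where "F = {p \<in> {i..<j}. p < mate p \<and> mate p < j}"
  have FN: "p < N" "p < mate p" "i \<le> p" "mate p < j" "w ! p \<in> inner i j" if "p \<in> F" for p
    using that jN by (auto simp: F_def inner_def)
  \<comment> \<open>Every inner chord is short, spanning just three exits, or long, spanning the
    second pattern.\<close>
  have SL: "(mate p = p + 4 \<and> exits (p+1) (p+4) = {p+1, p+2, p+3}) \<or>
     (mate p = p + 8 \<and> mate (p+1) = p + 5 \<and> mate (p+3) = p + 7 \<and> exits (p+1) (p+8) = {p+2, p+4, p+6})"
    if p: "p \<in> F" for p
  proof (cases "inner (Suc p) (mate p) = {}")
    case True
    then have all: "exits (Suc p) (mate p) = {Suc p..<mate p}"
      by (auto simp: exits_def inner_def)
    then have "mate p - Suc p = 3"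
      using card_exits_chord[OF FN(1,2)[OF p]] by simp
    then have "mate p = p + 4" by simp
    moreover have "{Suc p..<p+4} = {p+1, p+2, p+3}" by auto
    ultimately show ?thesis using all by simp
  next
    case False
    have "inner (Suc p) (mate p) \<subseteq> inner i j"
      using FN[OF p] by (intro inner_mono) auto
    then have "(mate p = Suc p + 5 \<and> mate (Suc p) = Suc p + 4 \<and> exits (Suc p) (mate p) = {Suc p+1, Suc p+2, Suc p+3}) \<or>
    (mate p = Suc p + 7 \<and> mate (Suc p) = Suc p + 4 \<and> mate (Suc p+2) = Suc p + 6 \<and> exits (Suc p) (mate p) = {Suc p+1, Suc p+3, Suc p+5})"
      using FN[OF p] jN card_exits_chord[OF FN(1,2)[OF p]] exits_of_chord_interior[OF FN(1,2)[OF p]] False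
      by (intro less.hyps) (auto intro: ntw[THEN notE])
    then show ?thesis
    proof
      assume a: "mate p = Suc p + 5 \<and> mate (Suc p) = Suc p + 4 \<and> exits (Suc p) (mate p) = {Suc p+1, Suc p+2, Suc p+3}"
      then have "Suc p \<in> F" using FN[OF p] by (auto simp: F_def)
      \<comment> \<open>The three exits inside \<open>p\<close> also leave the interior of
        \<open>Suc p\<close>, so two neighbourhoods of size three coincide.\<close>
      have "k \<in> exits (Suc (Suc p)) (mate (Suc p))" if k: "k \<in> exits (Suc p) (mate p)" for k
      proof -
        have m: "mate p = p + 6" "mate (Suc p) = p + 5" using a by auto
        have "k \<in> {Suc p+1, Suc p+2, Suc p+3}" using k a by blast
        moreover have "mate k \<notin> {Suc p..<p + 6}" using k m by (simp add: exits_def)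
        ultimately show ?thesis unfolding exits_def m by auto
      qed
      then have "nbh w (w ! p) \<subseteq> nbh w (w ! Suc p)"
        using nbh_eq FN[OF p] FN[OF \<open>Suc p \<in> F\<close>] by auto
      then have "nbh w (w ! p) = nbh w (w ! Suc p)"
        using deg3 FN(1)[OF p] FN(1)[OF \<open>Suc p \<in> F\<close>]
        by (intro card_subset_eq) auto
      moreover have "w ! p \<noteq> w ! Suc p"
        using nth_eq_iff[of p "Suc p"] FN[OF p] FN[OF \<open>Suc p \<in> F\<close>] a by auto
      moreover have "w ! p \<notin> nbh w (w ! p)" by (simp add: nbh_def interlaced_def)
      moreover have "w ! Suc p \<notin> nbh w (w ! Suc p)" by (simp add: nbh_def interlaced_def)
      ultimately have "letter_twins w (w ! p) (w ! Suc p)"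
        using FN(1)[OF p] FN(1)[OF \<open>Suc p \<in> F\<close>] by (auto simp: letter_twins_def)
      then show ?thesis using ntw FN(5)[OF p] FN(5)[OF \<open>Suc p \<in> F\<close>] by blast
    next
      assume a: "mate p = Suc p + 7 \<and> mate (Suc p) = Suc p + 4 \<and> mate (Suc p+2) = Suc p + 6 \<and> exits (Suc p) (mate p) = {Suc p+1, Suc p+3, Suc p+5}"
      have "{Suc p+1, Suc p+3, Suc p+5} = {p+2, p+4, p+6}" by (simp add: add.commute)
      moreover have m: "mate p = p + 8" "mate (p + 1) = p + 5" using a by auto
      moreover have "Suc p + 2 = p + 3" "Suc p + 6 = p + 7" by simp_all
      ultimately show ?thesis using a by (metis Suc_eq_plus1)
    qed
  qed
  have S: "mate p = p + 4 \<and> exits (p+1) (p+4) = {p+1, p+2, p+3}" if p: "p \<in> F" for p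
  proof (rule ccontr)
    assume "\<not> ?thesis"
    then have L: "mate p = p + 8" "mate (p+1) = p + 5" "mate (p+3) = p + 7"
      and e: "exits (p+1) (p+8) = {p+2, p+4, p+6}" using SL[OF p] by auto
    have m4: "mate (p+4) \<notin> {p+1..<p+8}" using e by (auto simp: exits_def set_eq_iff)
    have pN: "p + 8 < j" using FN[OF p] L by simp
    have i4: "p+4 \<in> {i..<j}" using FN(3)[OF p] pN by auto
    have mm: "mate (p+8) = p" "mate (p+5) = p+1" "mate (p+7) = p+3"
      using L mate_mate[of p] mate_mate[of "p+1"] mate_mate[of "p+3"] pN jN by auto
    \<comment> \<open>Otherwise \<open>p+4\<close> is an end of an inner chord, and
      \<open>SL\<close> for that chord gives some position near \<open>p\<close> a mate other than
      the one already known.\<close>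
    have "mate (p+4) \<notin> {i..<j}"
    proof
      assume m: "mate (p+4) \<in> {i..<j}"
      show False
      proof (cases "p + 4 < mate (p+4)")
        case True
        then have "p+4 \<in> F" using i4 m by (auto simp: F_def)
        have "p + 4 + 4 = p + 8" "p + 4 + 8 = p + 12" "p + 4 + 1 = p + 5" "p + 4 + 5 = p + 9" by simp_all
        then have "mate (p+4) = p + 8 \<or> mate (p+5) = p + 9" using SL[OF \<open>p+4 \<in> F\<close>] by metis
        moreover have "mate (mate (p+4)) = p+4" using pN jN by simp
        ultimately show False using mm by auto
      next
        case False
        define q where "q = mate (p+4)"
        have q: "mate q = p+4" using mate_mate[of "p+4"] pN jN q_def by auto
        have "q \<noteq> p+4" using mate_neq[of "p+4"] pN jN q_def by auto
        then have "q \<in> F" using False i4 m q by (auto simp: F_def q_def)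
        from SL[OF this] show False
        proof
          assume "mate q = q + 4 \<and> exits (q + 1) (q + 4) = {q + 1, q + 2, q + 3}"
          then have "q = p" using q by simp
          then show False using q L by simp
        next
          assume "mate q = q + 8 \<and> mate (q + 1) = q + 5 \<and> mate (q + 3) = q + 7 \<and> exits (q + 1) (q + 8) = {q + 2, q + 4, q + 6}"
          then have "p = q + 4" "mate (q+3) = q + 7" using q by auto
          moreover have "q + 3 < N" using calculation pN jN by simp
          ultimately have "mate (p+3) = q+3" using mate_mate[of "q+3"] by (simp add: eval_nat_numeral)
          then show False using L \<open>p = q + 4\<close> by simp
        qed
      qed
    qed
    then have k: "p+4 \<in> exits i j" using i4 by (auto simp: exits_def)
    have innerI: "w ! k \<in> inner i j" if "k \<in> {i..<j}" "mate k \<in> {i..<j}" for k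
      using that unfolding inner_def by blast
    have in3: "w ! p \<in> inner i j" "w ! (p+1) \<in> inner i j" "w ! (p+3) \<in> inner i j"
      using FN(3)[OF p] pN L by (auto intro!: innerI simp del: One_nat_def add_Suc_right)
    \<comment> \<open>The chords starting at \<open>p\<close>, \<open>p+1\<close> and
      \<open>p+3\<close> all pass over \<open>p+4\<close>, whose mate is outside the
      interval.\<close>
    have "p + 4 \<in> exits (Suc p) (mate p)" using L e by simp
    moreover have "p + 4 \<in> exits (Suc (p+1)) (mate (p+1))" "p + 4 \<in> exits (Suc (p+3)) (mate (p+3))"
      using L m4 by (auto simp: exits_def)
    ultimately have "w ! p \<in> nbh w (w ! (p+4))" "w ! (p+1) \<in> nbh w (w ! (p+4))" "w ! (p+3) \<in> nbh w (w ! (p+4))"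
      using pN jN L by (auto intro!: exits_chord_nbh)
    then have sub: "{w ! p, w ! (p+1), w ! (p+3)} \<subseteq> nbh w (w ! (p+4)) \<inter> inner i j"
      using in3 by auto
    have "w ! p \<noteq> w ! (p+1)" "w ! p \<noteq> w ! (p+3)" "w ! (p+1) \<noteq> w ! (p+3)"
      using nth_eq_iff[of p "p+1"] nth_eq_iff[of p "p+3"] nth_eq_iff[of "p+1" "p+3"] L pN jN by auto
    then have "card {w ! p, w ! (p+1), w ! (p+3)} = 3" by auto
    then have "3 \<le> card (nbh w (w ! (p+4)) \<inter> inner i j)"
      using card_mono[OF _ sub] by simp
    then show False using less.prems(3)[OF k] by simp
  qed
  have nbS: "nbh w (w ! p) = {w ! (p+1), w ! (p+2), w ! (p+3)}" if "p \<in> F" for p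
    using nbh_eq[OF FN(1,2)[OF that]] S[OF that] by simp
  \<comment> \<open>Position \<open>p+4\<close> carries the letter of \<open>p\<close>, so both
    chords meet the letters at \<open>p+2\<close> and \<open>p+3\<close> and each other: adjacent
    twins.\<close>
  have nocons: "Suc p \<notin> F" if p: "p \<in> F" for p
  proof
    assume s: "Suc p \<in> F"
    have m: "mate p = p + 4" using S[OF p] by simp
    have "w ! (p+4) = w ! p" using nth_mate[OF FN(1)[OF p]] m by simp
    moreover have "nbh w (w ! Suc p) = {w ! (p+2), w ! (p+3), w ! (p+4)}"
      using nbS[OF s] by (simp add: eval_nat_numeral)
    moreover have "w ! p \<noteq> w ! Suc p"
        using nth_eq_iff[of p "Suc p"] FN[OF p] FN[OF s] m by auto
    moreover have "w ! p \<notin> nbh w (w ! p)" by (simp add: nbh_def interlaced_def)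
    moreover have "w ! Suc p \<notin> nbh w (w ! Suc p)" by (simp add: nbh_def interlaced_def)
    ultimately have "letter_twins w (w ! p) (w ! Suc p)"
      using FN(1)[OF p] FN(1)[OF s] nbS[OF p] by (auto simp: letter_twins_def)
    then show False using ntw FN(5)[OF p] FN(5)[OF s] by blast
  qed
  \<comment> \<open>By \<open>S\<close>, right ends of inner chords are exactly the positions
    \<open>p + 4\<close> with \<open>p\<close> in \<open>F\<close>; every other position outside
    \<open>F\<close> is an exit.\<close>
  have exitI: "k \<in> exits i j" if "k \<in> {i..<j}" "k \<notin> F" "\<And>p. p \<in> F \<Longrightarrow> k \<noteq> p + 4" for k
  proof (rule ccontr)
    assume "k \<notin> exits i j"
    then have m: "mate k \<in> {i..<j}" using that by (simp add: exits_def)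
    have kN: "k < N" using that jN by simp
    have "mate k < k" using that m mate_neq[OF kN] by (auto simp: F_def)
    then have mF: "mate k \<in> F" using m that(1) mate_mate[OF kN] by (auto simp: F_def)
    have "mate (mate k) = mate k + 4" using S[OF mF] by blast
    then have "k = mate k + 4" using mate_mate[OF kN] by simp
    then show False using that(3)[OF mF] by blast
  qed
  have finF: "finite F" by (simp add: F_def)
  have "F \<noteq> {}"
  proof -
    obtain k where k: "k \<in> {i..<j}" "mate k \<in> {i..<j}" using less.prems(5) by (auto simp: inner_def)
    then have "k \<in> F \<or> mate k \<in> F"
      using mate_neq[of k] mate_mate[of k] jN by (auto simp: F_def)
    then show ?thesis by auto
  qed
  define a where "a = Min F"
  define b where "b = Max F"
  have a: "a \<in> F" "\<And>p. p \<in> F \<Longrightarrow> a \<le> p" and b: "b \<in> F" "\<And>p. p \<in> F \<Longrightarrow> p \<le> b"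
    using finF \<open>F \<noteq> {}\<close> by (auto simp: a_def b_def)
  have ma: "mate a = a + 4" and mb: "mate b = b + 4" using S a b by auto
  have ai: "i \<le> a" "a + 4 < j" and bi: "i \<le> b" "b + 4 < j" using FN[OF a(1)] FN[OF b(1)] ma mb by auto
  have ab: "a \<le> b" using a b by simp
  have fewer: "card X \<le> 3" if "X \<subseteq> exits i j" for X
    using card_mono[OF finite_exits that] less.prems(2) by simp
  have exact: "exits i j = X" if "X \<subseteq> exits i j" "card X = 3" for X
    using card_seteq[OF finite_exits that(1)] that(2) less.prems(2) by simp
  have a1: "a + 1 \<in> exits i j"
    using ai nocons[OF a(1)] by (intro exitI) (auto dest: a(2))
  \<comment> \<open>Mirror image of \<open>a1\<close>: position \<open>b + 3\<close> could only be
    the right end of a chord starting at \<open>b - 1\<close>, next to \<open>b\<close>.\<close>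
  have b3: "b + 3 \<in> exits i j"
  proof (rule exitI)
    fix p assume "p \<in> F"
    then show "b + 3 \<noteq> p + 4" using nocons[of p] b(1) by auto
  qed (use bi b(2) in force)+
  have fill: "k \<in> exits i j \<union> F \<union> (\<lambda>p. p + 4) ` F" if "k \<in> {i..<j}" for k
    using exitI[of k] that by auto
  have "b \<noteq> a + 1" using nocons[OF a(1)] b(1) by auto
  then consider "b = a" | "b = a + 2" | "a + 3 \<le> b"
    using ab by linarith
  then show ?case
  proof cases
    case 1
    have F1: "F = {a}" using a b 1 by (auto intro: antisym)
    have "a + 2 \<in> exits i j" "a + 3 \<in> exits i j"
      using ai F1 by (auto intro!: exitI)
    then have X: "exits i j = {a+1, a+2, a+3}" using a1 by (intro exact) auto
    \<comment> \<open>By \<open>fill\<close> nothing lies outside the pattern; testing the first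
      position \<open>i\<close> and the last position \<open>j - 1\<close> determines the
      interval.\<close>
    have sub: "a \<le> k \<and> k \<le> a + 4" if "k \<in> {i..<j}" for k
      using fill[OF that] unfolding X F1 by auto
    have "i = a" using sub[of i] ai by simp
    moreover have "j - 1 \<le> a + 4" using sub[of "j - 1"] ai by simp
    ultimately have "i = a" "j = a + 5" using ai by linarith+
    then show ?thesis using X ma by simp
  next
    case 2
    have F2: "F = {a, a+2}" 
    proof -
      have "p = a \<or> p = a + 2" if "p \<in> F" for p
      proof -
        have "p \<noteq> a + 1" using nocons[OF a(1)] that by auto
        then show ?thesis using a(2)[OF that] b(2)[OF that] 2 by linarith
      qed
      then show ?thesis using a(1) b(1) 2 by auto
    qed
    have "a + 3 \<in> exits i j"
      using ai F2 by (intro exitI) auto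
    then have X: "exits i j = {a+1, a+3, a+5}" using a1 b3 2 by (intro exact) (auto simp: eval_nat_numeral)
    have sub: "a \<le> k \<and> k \<le> a + 6" if "k \<in> {i..<j}" for k
      using fill[OF that] unfolding X F2 by auto
    have "i = a" using sub[of i] ai by simp
    moreover have "j - 1 \<le> a + 6" using sub[of "j - 1"] ai by simp
    ultimately have "i = a" "j = a + 7" using bi 2 by linarith+
    then show ?thesis using X ma mb 2 by simp
  next
    case 3
    \<comment> \<open>A second exit \<open>c\<close> near the left end and a second exit
      \<open>d\<close> near the right end give four exits in all; \<open>a + 3 \<le> b\<close> keeps
      \<open>c\<close> below \<open>d\<close>.\<close>
    have "a + 2 \<in> exits i j \<or> a + 3 \<in> exits i j"
    proof (cases "a + 2 \<in> F")
      case True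
      then have "a + 3 \<notin> F" using nocons[of "a+2"] by (simp add: eval_nat_numeral)
      then have "a + 3 \<in> exits i j" using ai by (intro exitI) (auto dest: a(2))
      then show ?thesis by simp
    next
      case False
      then have "a + 2 \<in> exits i j" using ai by (intro exitI) (auto dest: a(2))
      then show ?thesis by simp
    qed
    then obtain c where c: "c \<in> exits i j" "c = a + 2 \<or> c = a + 3" by blast
    have "b + 1 \<in> exits i j \<or> b + 2 \<in> exits i j"
    proof (rule ccontr)
      assume n: "\<not> ?thesis"
      \<comment> \<open>Both positions would be right ends, of chords starting consecutively at
        \<open>b - 3\<close> and \<open>b - 2\<close>.\<close>
      have "\<exists>p \<in> F. b + 1 = p + 4" "\<exists>p \<in> F. b + 2 = p + 4"
        using exitI[of "b+1"] exitI[of "b+2"] n bi b(2) by force+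
      then obtain p q where "p \<in> F" "q \<in> F" "b + 1 = p + 4" "b + 2 = q + 4" by blast
      moreover have "q = Suc p" using calculation by linarith
      ultimately show False using nocons[of p] by simp
    qed
    then obtain d where d: "d \<in> exits i j" "d = b + 1 \<or> d = b + 2" by blast
    have "card {a+1, c, d, b+3} = 4" using c d 3 by auto
    moreover have "card {a+1, c, d, b+3} \<le> 3" using a1 b3 c d by (intro fewer) auto
    ultimately have False by simp
    then show ?thesis ..
  qed
qed

section \<open>Adjacency by positions, and twins inside intervals\<close>

lemma inner_iff:
  assumes "k < N" "j \<le> N"
  shows "w ! k \<in> inner i j \<longleftrightarrow> k \<in> {i..<j} \<and> mate k \<in> {i..<j}"
proof
  assume "w ! k \<in> inner i j"
  then obtain l where l: "w ! k = w ! l" "l \<in> {i..<j}" "mate l \<in> {i..<j}" by (auto simp: inner_def)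
  then have "l = k \<or> l = mate k" using nth_eq_iff[of k l] assms by simp
  then show "k \<in> {i..<j} \<and> mate k \<in> {i..<j}" using l mate_mate[OF assms(1)] by auto
next
  assume "k \<in> {i..<j} \<and> mate k \<in> {i..<j}"
  then show "w ! k \<in> inner i j" unfolding inner_def by blast
qed

text \<open>Crossing as an exclusive or, insensitive to which end \<open>k\<close> of the second
  chord is given; the case analyses on arcs decide adjacency with it.\<close>

lemma nbh_iff:
  assumes "p < N" "p < mate p" "k < N"
  shows "w ! k \<in> nbh w (w ! p) \<longleftrightarrow> (k \<in> {p<..<mate p}) \<noteq> (mate k \<in> {p<..<mate p})"
proof -
  have P: "mate p < N" "mate k < N" using assms mate_less by auto
  have "w ! k \<in> nbh w (w ! p) \<longleftrightarrow> k \<in> exits (Suc p) (mate p) \<or> mate k \<in> exits (Suc p) (mate p)"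
  proof
    assume "w ! k \<in> nbh w (w ! p)"
    then obtain l where l: "l \<in> exits (Suc p) (mate p)" "w ! k = w ! l" using nbh_eq[OF assms(1,2)] by blast
    then have "l < N" using P by (auto simp: exits_def)
    then show "k \<in> exits (Suc p) (mate p) \<or> mate k \<in> exits (Suc p) (mate p)"
      using l nth_eq_iff[OF assms(3)] by auto
  next
    assume "k \<in> exits (Suc p) (mate p) \<or> mate k \<in> exits (Suc p) (mate p)"
    then show "w ! k \<in> nbh w (w ! p)"
      unfolding nbh_eq[OF assms(1,2)] using nth_mate[OF assms(3)] by (metis imageI)
  qed
  also have "\<dots> \<longleftrightarrow> (k \<in> {p<..<mate p}) \<noteq> (mate k \<in> {p<..<mate p})"
    using assms(3) by (auto simp: exits_def)
  finally show ?thesis .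
qed

lemma not_in_own_nbh [simp]: "x \<notin> nbh w x"
  by (simp add: nbh_def interlaced_def)

lemma nbh_subset: "nbh w x \<subseteq> set w"
  by (auto simp: nbh_def dest: interlaced_in_set)

lemma nbh_eqI:
  assumes "x \<in> set w" "A \<subseteq> nbh w x" "card A = 3"
  shows "nbh w x = A"
  using card_subset_eq[of "nbh w x" A] assms deg3 by simp

lemma letter_twinsI:
  assumes "x \<in> set w" "y \<in> set w" "x \<noteq> y" "nbh w x = nbh w y"
  shows "letter_twins w x y"
  using assms not_in_own_nbh[of x] not_in_own_nbh[of y] by (auto simp: letter_twins_def)

text \<open>Neighbours known not to be inner are subtracted from the degree, which yields the bounds
  that the interval lemmas demand of exits.\<close>

lemma card_nbh_inner:
  assumes "k < N" "A \<subseteq> nbh w (w ! k)" "A \<inter> inner i j = {}"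
  shows "card (nbh w (w ! k) \<inter> inner i j) \<le> 3 - card A"
proof -
  have "nbh w (w ! k) \<inter> inner i j \<subseteq> nbh w (w ! k) - A" using assms by blast
  then have "card (nbh w (w ! k) \<inter> inner i j) \<le> card (nbh w (w ! k) - A)"
    by (intro card_mono) auto
  also have "\<dots> = 3 - card A"
    using assms deg3[of "w ! k"] by (simp add: card_Diff_subset finite_subset[OF assms(2)])
  finally show ?thesis .
qed

text \<open>Both patterns of \<open>few_exits_cases\<close> have exactly three exits, so with fewer
  of them the absence of twins must fail.\<close>

lemma two_exits_twins:
  assumes "j \<le> N" "card (exits i j) \<le> 2"
    and "\<And>k. k \<in> exits i j \<Longrightarrow> card (nbh w (w ! k) \<inter> inner i j) \<le> 2"
    and "inner i j \<noteq> {}"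
  shows "\<exists>x \<in> inner i j. \<exists>y \<in> inner i j. letter_twins w x y"
proof (rule ccontr)
  assume n: "\<not> ?thesis"
  have "(j = i + 5 \<and> mate i = i + 4 \<and> exits i j = {i+1, i+2, i+3}) \<or>
    (j = i + 7 \<and> mate i = i + 4 \<and> mate (i+2) = i + 6 \<and> exits i j = {i+1, i+3, i+5})"
    by (rule few_exits_cases) (use assms n in auto)
  then have "card (exits i j) = 3" by auto
  then show False using assms(2) by simp
qed

text \<open>The whole word is an interval without exits, in which every letter is inner.\<close>

lemma exists_letter_twins:
  assumes "w \<noteq> []"
  shows "\<exists>x y. letter_twins w x y"
proof -
  have "exits 0 N = {}" by (auto simp: exits_def mate_less)
  moreover have "w ! 0 \<in> inner 0 N" using assms mate_less[of 0] by (subst inner_iff) auto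
  ultimately show ?thesis using two_exits_twins[of N 0] by auto
qed

text \<open>Every exit of the interior is adjacent to both \<open>w ! p\<close> and its twin
  \<open>z\<close>, so it meets at most one inner letter. The middle exit of the second pattern
  meets two; in the first pattern, two exits share the neighbours \<open>w ! p\<close>,
  \<open>z\<close> and the inner letter, and are twins.\<close>

lemma twin_interior:
  assumes p: "p < N" "p < mate p" and z: "z \<noteq> w ! p" "nbh w z = nbh w (w ! p)"
    and zI: "z \<notin> inner (Suc p) (mate p)" and ne: "inner (Suc p) (mate p) \<noteq> {}"
  shows "\<exists>r s. letter_twins w r s \<and> {r, s} \<inter> {w ! p, z} = {}"
proof (cases "\<exists>x \<in> inner (Suc p) (mate p). \<exists>y \<in> inner (Suc p) (mate p). letter_twins w x y")
  case True
  then show ?thesis using zI p inner_iff[OF p(1), of "mate p" "Suc p"] mate_less[OF p(1)] by fastforce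
next
  case False
  have mp: "mate p \<le> N" using mate_less[OF p(1)] by simp
  have pI: "w ! p \<notin> inner (Suc p) (mate p)" using inner_iff[OF p(1) mp, of "Suc p"] by simp
  have T: "{w ! p, z} \<subseteq> nbh w (w ! k)" if "k \<in> exits (Suc p) (mate p)" for k
    using exits_chord_nbh[OF p that] z nbh_sym by blast
  have kN: "k < N" if "k \<in> exits (Suc p) (mate p)" for k using that mp by (auto simp: exits_def)
  have le1: "card (nbh w (w ! k) \<inter> inner (Suc p) (mate p)) \<le> 1" if "k \<in> exits (Suc p) (mate p)" for k
    using card_nbh_inner[OF kN[OF that] T[OF that], of "Suc p" "mate p"] pI zI z(1) by auto
  have "(mate p = Suc p + 5 \<and> mate (Suc p) = Suc p + 4 \<and> exits (Suc p) (mate p) = {Suc p+1, Suc p+2, Suc p+3}) \<or>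
    (mate p = Suc p + 7 \<and> mate (Suc p) = Suc p + 4 \<and> mate (Suc p+2) = Suc p + 6 \<and> exits (Suc p) (mate p) = {Suc p+1, Suc p+3, Suc p+5})"
  proof (rule few_exits_cases)
    show "card (nbh w (w ! k) \<inter> inner (Suc p) (mate p)) \<le> 2" if "k \<in> exits (Suc p) (mate p)" for k
      using le1[OF that] by simp
  qed (use mp card_exits_chord[OF p] False ne in auto)
  then show ?thesis
  proof
    assume a: "mate p = Suc p + 5 \<and> mate (Suc p) = Suc p + 4 \<and> exits (Suc p) (mate p) = {Suc p+1, Suc p+2, Suc p+3}"
    define u where "u = Suc p"
    have u: "u < N" "mate u = u + 4" "u + 5 \<le> N" using a mp p by (auto simp: u_def)
    have exits: "u + 1 \<in> exits (Suc p) (mate p)" "u + 2 \<in> exits (Suc p) (mate p)" using a by (auto simp: u_def)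
    have uI: "w ! u \<in> inner (Suc p) (mate p)" using inner_iff[OF u(1) mp, of "Suc p"] a u_def by simp
    have nb: "nbh w (w ! k) = {w ! p, z, w ! u}" if "k = u + 1 \<or> k = u + 2" for k
    proof (rule nbh_eqI)
      have k: "k \<in> exits (Suc p) (mate p)" using that exits by blast
      then show "w ! k \<in> set w" using kN by simp
      have "mate k \<notin> {u..<u+5}" using k a by (simp add: exits_def u_def)
      then have "k \<in> exits (Suc u) (mate u)" using that u by (auto simp: exits_def)
      then have "w ! u \<in> nbh w (w ! k)" using u by (intro exits_chord_nbh) auto
      then show "{w ! p, z, w ! u} \<subseteq> nbh w (w ! k)" using T[OF k] by simp
      have "w ! u \<noteq> w ! p" "w ! u \<noteq> z" using pI zI uI by auto
      then show "card {w ! p, z, w ! u} = 3" using z by auto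
    qed
    have "w ! (u+1) \<noteq> w ! (u+2)" using inj_onD[OF inj_exits[OF mp, of "Suc p"], of "u+1" "u+2"] exits by auto
    then have "letter_twins w (w ! (u+1)) (w ! (u+2))"
      using nb kN[OF exits(1)] kN[OF exits(2)] by (intro letter_twinsI) auto
    moreover have "w ! (u+1) \<notin> {w ! p, z}" "w ! (u+2) \<notin> {w ! p, z}"
      using T[OF exits(1)] T[OF exits(2)] not_in_own_nbh by auto
    ultimately show ?thesis by blast
  next
    assume a: "mate p = Suc p + 7 \<and> mate (Suc p) = Suc p + 4 \<and> mate (Suc p+2) = Suc p + 6 \<and> exits (Suc p) (mate p) = {Suc p+1, Suc p+3, Suc p+5}"
    define u where "u = Suc p"
    have u: "u + 7 \<le> N" "mate u = u + 4" "mate (u+2) = u + 6" using a mp p by (auto simp: u_def)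
    have k: "u + 3 \<in> exits (Suc p) (mate p)" using a by (auto simp: u_def)
    have m: "mate (u+3) \<notin> {u..<u+7}" using k a by (simp add: exits_def u_def)
    have "w ! u \<in> nbh w (w ! (u+3))" "w ! (u+2) \<in> nbh w (w ! (u+3))"
      using u m by (auto intro!: exits_chord_nbh simp: exits_def)
    moreover have "w ! u \<in> inner (Suc p) (mate p)" "w ! (u+2) \<in> inner (Suc p) (mate p)"
      using inner_iff[OF _ mp, of u "Suc p"] inner_iff[OF _ mp, of "u+2" "Suc p"] u a u_def by auto
    moreover have "w ! u \<noteq> w ! (u+2)" using nth_eq_iff[of u "u+2"] u by auto
    ultimately have "card {w ! u, w ! (u+2)} \<le> card (nbh w (w ! (u+3)) \<inter> inner (Suc p) (mate p))"
      by (intro card_mono) auto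
    then show ?thesis using le1[OF k] \<open>w ! u \<noteq> w ! (u+2)\<close> by simp
  qed
qed

section \<open>A second pair from the arcs cut out by the first\<close>

lemma second_pair_adjacent:
  assumes q: "0 < q" "q < mate 0" "mate 0 < mate q" "q < N"
    and tw: "letter_twins w (w ! 0) (w ! q)"
  shows "\<exists>r s. letter_twins w r s \<and> {r, s} \<inter> {w ! 0, w ! q} = {}"
proof -
  \<comment> \<open>The four open arcs between the ends of two crossing chords. As one end is at
    position 0, no arc wraps around.\<close>
  define S where "S = {(1, q), (Suc q, mate 0), (Suc (mate 0), mate q), (Suc (mate q), N)}"
  have pos: "0 < N" "0 < mate 0" "q < mate q" using q by auto
  have mN: "mate 0 < N" "mate q < N" using mate_less pos q by auto
  have S: "0 < i" "j \<le> N" "0 \<notin> {i..<j}" "q \<notin> {i..<j}" "mate 0 \<notin> {i..<j}" "mate q \<notin> {i..<j}"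
    if "(i, j) \<in> S" for i j
    using that q mN unfolding S_def by auto
  define A where "A = nbh w (w ! 0) - {w ! q}"
  have A': "A = nbh w (w ! q) - {w ! 0}" using tw by (auto simp: A_def letter_twins_def)
  have adj: "w ! q \<in> nbh w (w ! 0)" using nbh_iff[of 0 q] q pos by auto
  have cA: "card A = 2" using adj deg3[of "w ! 0"] pos by (simp add: A_def)
  \<comment> \<open>Any two of the arcs are separated by one of the two twin chords, so a chord
    leaving an arc crosses a twin and belongs to the common neighbours \<open>A\<close>.\<close>
  have exA: "w ! k \<in> A" if ij: "(i, j) \<in> S" and k: "k \<in> exits i j" for i j k
  proof -
    have k': "k \<in> {i..<j}" "mate k \<notin> {i..<j}" using k by (auto simp: exits_def)
    have kN: "k < N" using k' S(2)[OF ij] by simp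
    have ne: "k \<notin> {0, q, mate 0, mate q}" using k'(1) S[OF ij] by blast
    have mk: "mate k < N" using mate_less kN by simp
    have ne': "mate k \<notin> {0, q, mate 0, mate q}"
    proof
      assume "mate k \<in> {0, q, mate 0, mate q}"
      then have "mate (mate k) \<in> {mate 0, mate q, 0, q}"
        using mate_mate[OF pos(1)] mate_mate[OF q(4)] by (elim insertE) simp_all
      then show False using ne mate_mate[OF kN] by auto
    qed
    have "w ! k \<in> nbh w (w ! 0) \<or> w ! k \<in> nbh w (w ! q)"
    proof -
      consider "i = 1 \<and> j = q" | "i = Suc q \<and> j = mate 0" | "i = Suc (mate 0) \<and> j = mate q"
        | "i = Suc (mate q) \<and> j = N" using ij unfolding S_def by auto
      then show ?thesis
        unfolding nbh_iff[OF pos(1,2) kN] nbh_iff[OF q(4) pos(3) kN] using k' ne' mk q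
        by cases auto
    qed
    moreover have "w ! k \<noteq> w ! 0" "w ! k \<noteq> w ! q"
      using nth_eq_iff[of 0 k] nth_eq_iff[of q k] pos q kN ne by auto
    ultimately have "w ! k \<in> nbh w (w ! 0) - {w ! q} \<or> w ! k \<in> nbh w (w ! q) - {w ! 0}" by blast
    then show ?thesis unfolding A_def[symmetric] A'[symmetric] by simp
  qed
  have notin: "w ! 0 \<notin> inner i j \<and> w ! q \<notin> inner i j" if "(i, j) \<in> S" for i j
    using S[OF that] inner_iff[OF pos(1), of j i] inner_iff[OF q(4), of j i] by blast
  show ?thesis
  proof (cases "\<exists>i j. (i, j) \<in> S \<and> inner i j \<noteq> {}")
    case True
    then obtain i j where ij: "(i, j) \<in> S" "inner i j \<noteq> {}" by blast
    have jN: "j \<le> N" using S(2) ij by blast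
    have "card (exits i j) = card ((!) w ` exits i j)" using card_image[OF inj_exits[OF jN]] by simp
    also have "\<dots> \<le> card A" using exA[OF ij(1)] by (intro card_mono) (auto simp: A_def)
    finally have c: "card (exits i j) \<le> 2" using cA by simp
    have "card (nbh w (w ! k) \<inter> inner i j) \<le> 2" if k: "k \<in> exits i j" for k
    proof -
      have "k < N" using k jN by (auto simp: exits_def)
      moreover have "{w ! 0} \<subseteq> nbh w (w ! k)" using exA[OF ij(1) k] nbh_sym by (auto simp: A_def)
      ultimately show ?thesis using card_nbh_inner[of k "{w ! 0}" i j] notin[OF ij(1)] by auto
    qed
    then obtain x y where "x \<in> inner i j" "y \<in> inner i j" "letter_twins w x y"
      using two_exits_twins[OF jN c _ ij(2)] by blast
    then show ?thesis using notin[OF ij(1)] by blast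
  next
    case False
    \<comment> \<open>Without inner letters all further chords leave their arcs, so the word has
      only four letters and its graph is complete.\<close>
    obtain a b where ab: "A = {a, b}" "a \<noteq> b" using cA by (auto simp: card_2_iff)
    have sub: "set w \<subseteq> {w ! 0, w ! q, a, b}"
    proof
      fix x assume "x \<in> set w"
      then obtain k where k: "k < N" "x = w ! k" by (auto simp: in_set_conv_nth)
      show "x \<in> {w ! 0, w ! q, a, b}"
      proof (cases "k \<in> {0, q, mate 0, mate q}")
        case True
        then show ?thesis using k nth_mate pos q by auto
      next
        case nk: False
        then have "\<exists>i j. (i, j) \<in> S \<and> k \<in> {i..<j}"
            using nk k q unfolding S_def by (simp add: conj_disj_distribR ex_disj_distrib) auto
        then obtain i j where ij: "(i, j) \<in> S" "k \<in> {i..<j}" by blast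
        then have "k \<in> exits i j" using False by (auto simp: exits_def inner_def)
        then show ?thesis using exA[OF ij(1)] ab k by auto
      qed
    qed
    have abw: "a \<in> set w" "b \<in> set w" using ab nbh_subset by (auto simp: A_def)
    have ne: "a \<noteq> w ! 0" "a \<noteq> w ! q" "b \<noteq> w ! 0" "b \<noteq> w ! q" using ab A' A_def by auto
    have n0: "w ! 0 \<noteq> w ! q" using tw by (simp add: letter_twins_def)
    have "nbh w a = {w ! 0, w ! q, b}"
    proof (rule sym, rule card_subset_eq[THEN sym])
      show "nbh w a \<subseteq> {w ! 0, w ! q, b}" using sub nbh_subset[of a] not_in_own_nbh[of a] by blast
      show "card (nbh w a) = card {w ! 0, w ! q, b}" using deg3[OF abw(1)] n0 ne by auto
    qed simp
    moreover have "nbh w b = {w ! 0, w ! q, a}"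
    proof (rule sym, rule card_subset_eq[THEN sym])
      show "nbh w b \<subseteq> {w ! 0, w ! q, a}" using sub nbh_subset[of b] not_in_own_nbh[of b] by blast
      show "card (nbh w b) = card {w ! 0, w ! q, a}" using deg3[OF abw(2)] n0 ne by auto
    qed simp
    ultimately have "letter_twins w a b" using abw ab ne by (auto simp: letter_twins_def)
    then show ?thesis using ne by blast
  qed
qed

text \<open>The twin chords lie side by side, and their common neighbours \<open>T\<close> run from
  the interior of one to that of the other. If no disjoint pair existed, hardly anything but these
  five chords could occur, and two letters of \<open>T\<close> would be twins.\<close>

lemma second_pair_nonadjacent:
  assumes q: "0 < mate 0" "mate 0 < q" "q < mate q" "q < N"
    and tw: "letter_twins w (w ! 0) (w ! q)"
  shows "\<exists>r s. letter_twins w r s \<and> {r, s} \<inter> {w ! 0, w ! q} = {}"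
proof (rule ccontr)
  assume n: "\<not> ?thesis"
  have pos: "0 < N" using q by auto
  have mN: "mate 0 < N" "mate q < N" using mate_less pos q by auto
  note iff0 = nbh_iff[OF pos q(1)] and iffq = nbh_iff[OF q(4,3)]
  have nadj: "w ! q \<notin> nbh w (w ! 0)" using iff0[OF q(4)] q by auto
  then have nadj': "w ! 0 \<notin> nbh w (w ! q)" using nbh_sym by blast
  define T where "T = nbh w (w ! 0)"
  have T': "T = nbh w (w ! q)" using tw nadj nadj' by (auto simp: T_def letter_twins_def)
  have cT: "card T = 3" using deg3[of "w ! 0"] pos by (simp add: T_def)
  have n0: "w ! 0 \<noteq> w ! q" using tw by (simp add: letter_twins_def)
  have Tw: "T \<subseteq> set w" "w ! 0 \<notin> T" "w ! q \<notin> T"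
    using nbh_subset nadj by (auto simp: T_def)
  have Tnb: "{w ! 0, w ! q} \<subseteq> nbh w a" if "a \<in> T" for a
    using that nbh_sym T' T_def by blast
  have Tpos: "\<exists>l. 0 < l \<and> l < mate 0 \<and> q < mate l \<and> mate l < mate q \<and> a = w ! l" if "a \<in> T" for a
  proof -
    obtain l where l: "l \<in> exits (Suc 0) (mate 0)" "a = w ! l"
      using \<open>a \<in> T\<close> nbh_eq[OF pos q(1)] by (auto simp: T_def)
    have lN: "l < N" using l mN by (auto simp: exits_def)
    have "w ! l \<in> nbh w (w ! q)" using that l T' by simp
    then show ?thesis using l q unfolding iffq[OF lN] by (intro exI[of _ l]) (auto simp: exits_def)
  qed
  have i0: "inner (Suc 0) (mate 0) = {}"
    using twin_interior[OF pos q(1), of "w ! q"] n n0 T' T_def inner_iff[OF q(4), of "mate 0" "Suc 0"] mN q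
    by auto
  have iq: "inner (Suc q) (mate q) = {}"
    using twin_interior[OF q(4,3), of "w ! 0"] n n0 T' T_def inner_iff[OF pos, of "mate q" "Suc q"] mN q
    by auto
  define S where "S = {(Suc (mate 0), q), (Suc (mate q), N)}"
  have S: "0 < i" "j \<le> N" "0 \<notin> {i..<j}" "q \<notin> {i..<j}" "mate 0 \<notin> {i..<j}" "mate q \<notin> {i..<j}"
    if "(i, j) \<in> S" for i j
    using that q mN unfolding S_def by auto
  \<comment> \<open>Such a chord cannot end below just one of the twins, so it joins the two outer
    arcs. It then separates the twins and crosses all three chords of \<open>T\<close>, which
    exhausts its degree.\<close>
  have exM: "nbh w (w ! k) = T" if ij: "(i, j) \<in> S" and k: "k \<in> exits i j" for i j k
  proof (rule nbh_eqI)
    have k': "k \<in> {i..<j}" "mate k \<notin> {i..<j}" using k by (auto simp: exits_def)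
    have kN: "k < N" using k' S(2)[OF ij] by simp
    then show "w ! k \<in> set w" by simp
    have ne: "k \<notin> {0, q, mate 0, mate q}" using k'(1) S[OF ij] by blast
    have mk: "mate k < N" using mate_less kN by simp
    have ne': "mate k \<notin> {0, q, mate 0, mate q}"
    proof
      assume "mate k \<in> {0, q, mate 0, mate q}"
      then have "mate (mate k) \<in> {mate 0, mate q, 0, q}"
        using mate_mate[OF pos] mate_mate[OF q(4)] by (elim insertE) simp_all
      then show False using ne mate_mate[OF kN] by auto
    qed
    have same: "(k \<in> {0<..<mate 0}) \<noteq> (mate k \<in> {0<..<mate 0}) \<longleftrightarrow> (k \<in> {q<..<mate q}) \<noteq> (mate k \<in> {q<..<mate q})"
      using T' T_def iff0[OF kN] iffq[OF kN] by blast
    have sides: "(mate 0 < k \<and> k < q \<and> mate q < mate k) \<or> (mate 0 < mate k \<and> mate k < q \<and> mate q < k)"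
    proof -
      consider "i = Suc (mate 0) \<and> j = q" | "i = Suc (mate q) \<and> j = N" using ij unfolding S_def by auto
      then show ?thesis using k' ne' mk q same by cases auto
    qed
    show "T \<subseteq> nbh w (w ! k)"
    proof
      fix a assume "a \<in> T"
      then obtain l where l: "0 < l" "l < mate 0" "q < mate l" "mate l < mate q" "a = w ! l" using Tpos by blast
      have lN: "l < N" and lm: "l < mate l" using l mN q by auto
      have "w ! k \<in> nbh w (w ! l)" unfolding nbh_iff[OF lN lm kN] using sides l q by auto
      then show "a \<in> nbh w (w ! k)" using nbh_sym l(5) by blast
    qed
  qed (rule cT)
  have notin: "w ! 0 \<notin> inner i j \<and> w ! q \<notin> inner i j \<and> T \<inter> inner i j = {}" if ij: "(i, j) \<in> S" for i j
  proof -
    have "w ! l \<notin> inner i j" if "0 < l" "l < mate 0" "q < mate l" "mate l < mate q" for l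
    proof -
      have "l \<notin> {i..<j} \<or> mate l \<notin> {i..<j}" using that ij q unfolding S_def by auto
      then show ?thesis using inner_iff[of l j i] S(2)[OF ij] that mN by auto
    qed
    then have "T \<inter> inner i j = {}" using Tpos by blast
    then show ?thesis using S[OF ij] inner_iff[OF pos, of j i] inner_iff[OF q(4), of j i] by blast
  qed
  \<comment> \<open>By \<open>exM\<close>, two exits of one arc would be twins.\<close>
  have one: "card (exits i j) \<le> 1" if ij: "(i, j) \<in> S" for i j
  proof (rule ccontr)
    assume "\<not> ?thesis"
    then obtain k l where kl: "k \<in> exits i j" "l \<in> exits i j" "k \<noteq> l"
      by (metis card_le_Suc0_iff_eq finite_exits One_nat_def)
    have jN: "j \<le> N" using S(2) ij by blast
    have N: "k < N" "l < N" using kl jN by (auto simp: exits_def)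
    have "w ! k \<noteq> w ! l" using inj_onD[OF inj_exits[OF jN], of k l] kl by blast
    then have "letter_twins w (w ! k) (w ! l)"
      using exM[OF ij kl(1)] exM[OF ij kl(2)] N by (intro letter_twinsI) auto
    moreover have "w ! x \<notin> {w ! 0, w ! q}" if "x = k \<or> x = l" for x
    proof -
      have x: "x \<in> {i..<j}" "x < N" using that kl N by (auto simp: exits_def)
      then have "x \<notin> {0, q, mate 0, mate q}" using S[OF ij] by blast
      then have "w ! 0 \<noteq> w ! x" "w ! q \<noteq> w ! x"
        using nth_eq_iff[OF pos x(2)] nth_eq_iff[OF q(4) x(2)] by blast+
      then show ?thesis by auto
    qed
    ultimately show False using n by blast
  qed
  have iM: "inner i j = {}" if ij: "(i, j) \<in> S" for i j
  proof (rule ccontr)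
    assume ne: "inner i j \<noteq> {}"
    have jN: "j \<le> N" using S(2) ij by blast
    have "card (exits i j) \<le> 2" using one[OF ij] by simp
    moreover have "card (nbh w (w ! k) \<inter> inner i j) \<le> 2" if "k \<in> exits i j" for k
      using exM[OF ij that] notin[OF ij] by simp
    ultimately obtain x y where "x \<in> inner i j" "y \<in> inner i j" "letter_twins w x y"
      using two_exits_twins[OF jN _ _ ne] by blast
    then show False using n notin[OF ij] by blast
  qed
  have tri: "nbh w a = {w ! 0, w ! q, c}" if "a \<in> T" "c \<in> nbh w a" "c \<noteq> w ! 0" "c \<noteq> w ! q" for a c
    using that Tnb[OF that(1)] Tw n0 by (intro nbh_eqI) auto
  obtain a b where ab: "a \<in> T" "b \<in> T" "a \<noteq> b"
    using cT by (metis card_3_iff insertI1 insertI2)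
  have abn: "a \<notin> {w ! 0, w ! q}" "b \<notin> {w ! 0, w ! q}" using ab Tw by auto
  show False
  proof (cases "\<exists>i j. (i, j) \<in> S \<and> exits i j \<noteq> {}")
    case True
    then obtain i j k where ij: "(i, j) \<in> S" "k \<in> exits i j" by blast
    have nk: "nbh w (w ! k) = T" by (rule exM[OF ij])
    have "w ! k \<noteq> w ! 0 \<and> w ! k \<noteq> w ! q"
    proof -
      have k: "k \<in> {i..<j}" using ij(2) by (simp add: exits_def)
      then have kN: "k < N" using S(2)[OF ij(1)] by simp
      have "k \<notin> {0, q, mate 0, mate q}" using k S[OF ij(1)] by blast
      then have "w ! 0 \<noteq> w ! k" "w ! q \<noteq> w ! k"
        using nth_eq_iff[OF pos kN] nth_eq_iff[OF q(4) kN] by blast+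
      then show ?thesis by auto
    qed
    \<comment> \<open>A chord joining the outer arcs is the third neighbour of every letter of
      \<open>T\<close>.\<close>
    then have "nbh w a = nbh w b"
      using tri[OF ab(1), of "w ! k"] tri[OF ab(2), of "w ! k"] nk ab nbh_sym by metis
    then have "letter_twins w a b" using ab Tw by (intro letter_twinsI) auto
    then show False using n abn by blast
  next
    case False
    have sub: "set w \<subseteq> {w ! 0, w ! q} \<union> T"
    proof
      fix x assume "x \<in> set w"
      then obtain k where k: "k < N" "x = w ! k" by (auto simp: in_set_conv_nth)
      have "k \<in> {0, q, mate 0, mate q} \<or> k \<in> {Suc 0..<mate 0} \<or> k \<in> {Suc q..<mate q} \<or>
          k \<in> {Suc (mate 0)..<q} \<or> k \<in> {Suc (mate q)..<N}"
        using k q by auto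
      then consider "k \<in> {0, q, mate 0, mate q}" | "k \<in> {Suc 0..<mate 0}" | "k \<in> {Suc q..<mate q}"
        | "\<exists>i j. (i, j) \<in> S \<and> k \<in> {i..<j}" unfolding S_def by blast
      then show "x \<in> {w ! 0, w ! q} \<union> T"
      proof cases
        case 1
        then show ?thesis using k nth_mate pos q by auto
      next
        case 2
        then have "mate k \<notin> {Suc 0..<mate 0}" using i0 by (auto simp: inner_def)
        then show ?thesis using 2 k iff0[OF k(1)] by (auto simp: T_def)
      next
        case 3
        then have "mate k \<notin> {Suc q..<mate q}" using iq by (auto simp: inner_def)
        then show ?thesis using 3 k iffq[OF k(1)] by (auto simp: T')
      next
        case 4
        then obtain i j where ij: "(i, j) \<in> S" "k \<in> {i..<j}" by blast
        then have "k \<in> exits i j" using iM[OF ij(1)] by (auto simp: exits_def inner_def)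
        then show ?thesis using False ij(1) by blast
      qed
    qed
    \<comment> \<open>The third neighbour \<open>c\<close> of \<open>a\<close> must itself lie in
      \<open>T\<close>, which makes \<open>a\<close> and \<open>c\<close> adjacent twins.\<close>
    have "\<not> nbh w a \<subseteq> {w ! 0, w ! q}"
    proof
      assume "nbh w a \<subseteq> {w ! 0, w ! q}"
      then have "card (nbh w a) \<le> card {w ! 0, w ! q}" by (intro card_mono) auto
      then show False using deg3[of a] ab Tw n0 by auto
    qed
    then obtain c where c: "c \<in> nbh w a" "c \<noteq> w ! 0" "c \<noteq> w ! q" by blast
    then have cT': "c \<in> T" using sub nbh_subset by blast
    have "nbh w a = {w ! 0, w ! q, c}" using tri ab c by blast
    moreover have "nbh w c = {w ! 0, w ! q, a}" using tri[OF cT'] c(1) nbh_sym abn by blast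
    moreover have "a \<noteq> c" using c(1) by auto
    ultimately have "letter_twins w a c"
      using ab cT' Tw abn c by (auto simp: letter_twins_def)
    then show False using n abn c by blast
  qed
qed

end

section \<open>Rotating the first pair into position\<close>

lemma cubic_word_rotate:
  assumes "cubic_word w"
  shows "cubic_word (rotate n w)"
proof -
  have rot1: "count_list (rotate1 v) x = count_list v x" for v :: "'a list" and x
    by (cases v) simp_all
  have "count_list (rotate n w) x = count_list w x" for x
    by (induction n) (simp_all add: rot1)
  then show ?thesis using assms by (auto simp: cubic_word_def double_occurrence_word_def)
qed

text \<open>Rotating \<open>x\<close> to position 0 leaves three configurations: crossing, side by
  side, or the chord of \<open>y\<close> nested below that of \<open>x\<close>. A further rotation
  to the other end of \<open>x\<close> turns the nested case into side by side.\<close>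

lemma two_letter_twin_pairs:
  assumes "cubic_word w" "w \<noteq> []"
  shows "\<exists>x y r s. letter_twins w x y \<and> letter_twins w r s \<and> distinct [x, y, r, s]"
proof -
  obtain x y where xy: "letter_twins w x y" using cubic_word.exists_letter_twins[OF assms] by blast
  define good where "good v \<longleftrightarrow> (\<exists>n. v = rotate n w) \<and> v ! 0 = x" for v
  have goodD: "cubic_word v" "letter_twins v = letter_twins w" "length v = length w" "set v = set w" if "good v" for v
    using that cubic_word_rotate[OF assms(1)] by (auto simp: good_def)
  have yex: "\<exists>q < length v. v ! q = y \<and> q < cubic_word.mate v q" if "good v" for v
  proof -
    interpret cubic_word v by (rule goodD[OF that])
    have "y \<in> set v" using xy goodD(4)[OF that] by (simp add: letter_twins_def)
    then obtain q where "q < length v" "v ! q = y" by (auto simp: in_set_conv_nth)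
    then show ?thesis using mate_props[of q] mate_mate[of q] by (metis linorder_neqE_nat)
  qed
  obtain k where k: "k < length w" "w ! k = x" using xy by (auto simp: letter_twins_def in_set_conv_nth)
  have "good (rotate k w)" using k assms(2) by (auto simp: good_def nth_rotate)
  then obtain v q where v: "good v" "q < length v" "v ! q = y" "q < cubic_word.mate v q"
    "\<not> cubic_word.mate v q < cubic_word.mate v 0"
  proof -
    assume g: "good (rotate k w)" and that: "\<And>v q. good v \<Longrightarrow> q < length v \<Longrightarrow> v ! q = y \<Longrightarrow>
      q < cubic_word.mate v q \<Longrightarrow> \<not> cubic_word.mate v q < cubic_word.mate v 0 \<Longrightarrow> thesis"
    define v where "v = rotate k w"
    have gv: "good v" using g v_def by simp
    interpret V: cubic_word v by (rule goodD[OF gv])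
    obtain q where q: "q < length v" "v ! q = y" "q < V.mate q" using yex[OF gv] by blast
    show thesis
    proof (cases "V.mate q < V.mate 0")
      case False
      then show thesis using that[OF gv q] by blast
    next
      case nested: True
      let ?P = "V.mate 0"
      have N0: "0 < length v" using q by auto
      have P: "?P < length v" "v ! ?P = x" using V.mate_props[OF N0] gv by (auto simp: good_def)
      define u where "u = rotate ?P v"
      have gu: "good u" using gv P N0 by (auto simp: good_def u_def nth_rotate rotate_rotate)
      interpret U: cubic_word u by (rule goodD[OF gu])
      obtain q2 where q2: "q2 < length u" "u ! q2 = y" "q2 < U.mate q2" using yex[OF gu] by blast
      have lu: "length u = length v" by (simp add: u_def)
      have "u ! (length v - ?P) = x"
        using P N0 nested gv by (simp add: u_def nth_rotate good_def)
      moreover have "u ! 0 = x" using gu by (simp add: good_def)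
      ultimately have mu: "U.mate 0 = length v - ?P"
        using U.nth_eq_iff[of 0 "length v - ?P"] P lu nested N0 by auto
      have "\<not> U.mate q2 < U.mate 0"
      proof
        \<comment> \<open>An end of \<open>y\<close> before \<open>U.mate 0\<close> would come from
          a position at or after \<open>?P\<close> in \<open>v\<close>, whereas both ends of
          \<open>y\<close> lie before \<open>?P\<close>.\<close>
        assume lt: "U.mate q2 < U.mate 0"
        then have "U.mate q2 + ?P < length v" using mu by simp
        then have "v ! (U.mate q2 + ?P) = u ! U.mate q2"
          using lu N0 by (simp add: u_def nth_rotate add.commute)
        also have "\<dots> = v ! q" using U.nth_mate[OF q2(1)] q2(2) q(2) by simp
        finally have "U.mate q2 + ?P = q \<or> U.mate q2 + ?P = V.mate q"
          using V.nth_eq_iff[OF q(1)] \<open>U.mate q2 + ?P < length v\<close> by metis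
        then show False using nested q(3) by auto
      qed
      then show thesis using that[OF gu q2] by blast
    qed
  qed
  interpret cubic_word v by (rule goodD[OF v(1)])
  have tw: "letter_twins v (v ! 0) (v ! q)" using xy goodD(2)[OF v(1)] v(1,3) by (simp add: good_def)
  then have ne: "v ! 0 \<noteq> v ! q" by (simp add: letter_twins_def)
  have N0: "0 < length v" using v(2) by auto
  have "0 < mate 0" using mate_neq[OF N0] by simp
  moreover have "q \<noteq> 0" using ne by metis
  moreover have "q \<noteq> mate 0" using ne nth_mate[OF N0] by metis
  moreover have "mate q \<noteq> mate 0"
    using ne nth_mate[OF N0] nth_mate[OF v(2)] by metis
  ultimately have "mate 0 < q \<or> (0 < q \<and> q < mate 0 \<and> mate 0 < mate q)" using v(4,5) by auto
  then have "\<exists>r s. letter_twins v r s \<and> {r, s} \<inter> {v ! 0, v ! q} = {}"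
    using second_pair_adjacent[of q] second_pair_nonadjacent[of q] v(2,4) tw \<open>0 < mate 0\<close> by blast
  then obtain r s where "letter_twins w r s" "{r, s} \<inter> {x, y} = {}"
    using goodD(2)[OF v(1)] v(1,3) by (auto simp: good_def)
  moreover have "x \<noteq> y" "r \<noteq> s" using xy calculation(1) by (auto simp: letter_twins_def)
  ultimately show ?thesis using xy by (intro exI[of _ x] exI[of _ y] exI[of _ r] exI[of _ s]) auto
qed

section \<open>From words back to graphs\<close>

theorem theorem2:
  fixes V :: "'a set" and E :: "'a \<Rightarrow> 'a \<Rightarrow> bool"
  assumes "simple_graph V E" and "V \<noteq> {}"
    and "regular 3 V E" and "circle_graph V E"
  shows "\<exists>v1 v2 w1 w2. distinct [v1, v2, w1, w2] \<and> twins V E v1 v2 \<and> twins V E w1 w2"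
proof -
  obtain w :: "nat list" and f where dow: "double_occurrence_word w" and f: "bij_betw f V (set w)"
    and E: "\<And>u v. u \<in> V \<Longrightarrow> v \<in> V \<Longrightarrow> E u v \<longleftrightarrow> interlaced w (f u) (f v)"
    using assms(4) unfolding circle_graph_def by blast
  have inj: "inj_on f V" and img: "f ` V = set w" using f by (auto simp: bij_betw_def)
  have sub: "neighbors V E v \<subseteq> V" for v by (auto simp: neighbors_def)
  have nb: "nbh w (f v) = f ` neighbors V E v" if v: "v \<in> V" for v
  proof -
    have "nbh w (f v) = {y \<in> f ` V. interlaced w (f v) y}"
      using img by (auto simp: nbh_def dest: interlaced_in_set)
    then show ?thesis using E[OF v] by (auto simp: neighbors_def)
  qed
  have "cubic_word w"
  proof
    fix x assume "x \<in> set w"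
    then obtain v where v: "v \<in> V" "x = f v" using img by blast
    have "card (f ` neighbors V E v) = card (neighbors V E v)"
      by (rule card_image[OF inj_on_subset[OF inj sub]])
    then show "card (nbh w x) = 3" using nb v assms(3) by (simp add: regular_def)
  qed (rule dow)
  moreover have "w \<noteq> []" using img assms(2) by auto
  ultimately obtain x y r s where tw: "letter_twins w x y" "letter_twins w r s" and d: "distinct [x, y, r, s]"
    using two_letter_twin_pairs by blast
  \<comment> \<open>Since \<open>f\<close> is injective on \<open>V\<close>, taking images commutes
    with removing a vertex and can be cancelled.\<close>
  have twin: "twins V E u v" if "letter_twins w (f u) (f v)" "u \<in> V" "v \<in> V" for u v
  proof -
    have "f ` (neighbors V E a - {b}) = f ` neighbors V E a - {f b}" if "a \<in> V" "b \<in> V" for a b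
      using inj_on_image_set_diff[OF inj, of "neighbors V E a" "{b}"] sub that by auto
    then have "f ` (neighbors V E u - {v}) = f ` (neighbors V E v - {u})"
      using that nb by (simp add: letter_twins_def)
    then have "neighbors V E u - {v} = neighbors V E v - {u}"
      using inj_on_image_eq_iff[OF inj, of "neighbors V E u - {v}" "neighbors V E v - {u}"] sub by blast
    then show ?thesis using that by (auto simp: twins_def letter_twins_def)
  qed
  obtain v1 v2 w1 w2 where "v1 \<in> V" "v2 \<in> V" "w1 \<in> V" "w2 \<in> V" "x = f v1" "y = f v2" "r = f w1" "s = f w2"
  proof -
    have "x \<in> f ` V" "y \<in> f ` V" "r \<in> f ` V" "s \<in> f ` V"
      using tw img by (auto simp: letter_twins_def)
    then show thesis using that by blast
  qed
  then have "distinct [v1, v2, w1, w2]" "twins V E v1 v2" "twins V E w1 w2"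
    using tw d twin by auto
  then show ?thesis by blast
qed

end
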